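(* Let $f=(f_1,\dots,f_m)^\top:\mathbb{R}^n\to\mathbb{R}^m$ with each $f_i$ continuously differentiable, and let $x_0\in\mathbb{R}^n$. Let $\mathcal{L}_{f(x_0)}=\{x\in\mathbb{R}^n : f_i(x)\le f_i(x_0)\ \text{for all } i\in[m]\}$. Let $\{x_k\}$ be an (infinite) sequence generated from $x_0$ by the BB-DQN algorithm (described in the context), with matrices $B_k$. Suppose that: (i) $\mathcal{L}_{f(x_0)}$ is bounded; (ii) there is an open set $C\supseteq \mathcal{L}_{f(x_0)}$ and, for each $i\in[m]$, a constant $L_i>0$ such that $\|\nabla f_i(x)-\nabla f_i(y)\|\le L_i\|x-y\|$ for all $x,y\in C$; (iii) there are constants $0<a\le b$ such that $aI_n\preceq B_k\preceq bI_n$ for all $k$. Then every accumulation point $x^*$ of $\{x_k\}$ is Pareto critical for $\min_{x\in\mathbb{R}^n}f(x)$, i.e. for every $d\in\mathbb{R}^n$ there exists $i\in[m]$ with $\langle\nabla f_i(x^* ),d\rangle\ge0$.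
   Context: Notation: $[m]=\{1,\dots,m\}$; $\Delta_m=\{\lambda\in\mathbb{R}^m:\lambda_i\ge0,\ \sum_i\lambda_i=1\}$; $\|\cdot\|$ is the Euclidean norm; $A\preceq B$ means $B-A$ is positive semidefinite; $\|v\|_M=\sqrt{v^\top Mv}$ for $M$ symmetric positive definite. For $x,d\in\mathbb{R}^n$, $\mathcal{D}(x,d)=\max_{i\in[m]}\nabla f_i(x)^\top d$. BB-DQN algorithm. Parameters: $c_0\in(0,1]$, $c_1,c_2,\mu\in(0,\infty)$, $0<\sigma_1<\sigma_2<1$, tolerance $\varepsilon\ge0$, $x_0\in\mathbb{R}^n$, symmetric positive definite $B_0\in\mathbb{R}^{n\times n}$, and a vector $\alpha^{-1}=(\alpha_1^{-1},\dots,\alpha_n^{-1})^\top$ with positive entries (superscripts on $\alpha_j$ are iteration indices, not powers). For $k=0,1,2,\dots$: 1. Let $\lambda^k\in\Delta_m$ be a minimizer of $\frac12\big\|\sum_{i}\lambda_i\nabla f_i(x_k)\big\|^2_{B_k^{-1}}$ over $\lambda\in\Delta_m$, and set $d_k=-B_k^{-1}\sum_{i}\lambda_i^k\nabla f_i(x_k)$ (equivalently, $d_k$ is the unique minimizer of $\max_{i}\nabla f_i(x_k)^\top d+\frac12 d^\top B_kd$). If $\|d_k\|<\varepsilon$ or $d_k=0$, stop. 2. Set $\omega_k=\min\{c_0,\,c_1\|d_k\|^{c_2}\}$. 3. Choose a step size $t_k>0$ such that $f_i(x_k+t_kd_k)\le f_i(x_k)+\sigma_1t_k\mathcal{D}(x_k,d_k)$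 for all $i\in[m]$, and $\mathcal{D}(x_k+t_kd_k,d_k)\ge\sigma_2\mathcal{D}(x_k,d_k)$. 4. Set $x_{k+1}=x_k+t_kd_k$, $s_k=t_kd_k$, $y_k=\sum_{i}\lambda_i^k(\nabla f_i(x_{k+1})-\nabla f_i(x_k))$. 5. If $s_k^\top y_k>0$ and $\big[\frac{y_k^\top s_k}{\|s_k\|^2},\frac{\|y_k\|^2}{y_k^\top s_k}\big]\cap[\omega_k,\omega_k^{-1}]\ne\varnothing$, set $\alpha_k^-=\max\{\frac{y_k^\top s_k}{\|s_k\|^2},\omega_k\}$ and $\alpha_k^+=\min\{\frac{\|y_k\|^2}{y_k^\top s_k},\omega_k^{-1}\}$; otherwise set $\alpha_k^-=\omega_k$, $\alpha_k^+=\omega_k^{-1}$. 6. For $j=1,\dots,n$, let $r_j=\frac{s_j^ky_j^k+\mu\alpha_j^{k-1}}{(s_j^k)^2+\mu}$, where $s_j^k,y_j^k$ are the $j$-th entries of $s_k,y_k$; set $\alpha_j^k=\alpha_k^-$ if $r_j<\alpha_k^-$, $\alpha_j^k=\alpha_k^+$ if $r_j>\alpha_k^+$, and $\alpha_j^k=r_j$ otherwise. The matrix used in the next iteration is $B_{k+1}=\mathrm{Diag}(\alpha_1^k,\dots,\alpha_n^k)$. *)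

theory Defs
  imports "HOL-Analysis.Analysis"
begin

text \<open>The vector function \<open>f = (f_1, \<dots>, f_m)\<close> is given as the family of its components
  \<open>f :: 'm \<Rightarrow> real ^ 'n \<Rightarrow> real\<close>, with the finite types \<open>'m\<close> and \<open>'n\<close> in the role of
  \<open>{1, \<dots>, m}\<close> and \<open>{1, \<dots>, n}\<close>.\<close>

text \<open>Meaningful only where the function is differentiable.\<close>
definition grad :: "(real ^ 'n \<Rightarrow> real) \<Rightarrow> real ^ 'n \<Rightarrow> real ^ 'n" where
  "grad h x = (THE g. GDERIV h x :> g)"

definition cont_differentiable :: "(real ^ 'n \<Rightarrow> real) \<Rightarrow> bool" where
  "cont_differentiable h \<longleftrightarrow> (\<forall>x. h differentiable (at x)) \<and> continuous_on UNIV (grad h)"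

definition pos_semidef :: "real ^ 'n ^ 'n \<Rightarrow> bool" where
  "pos_semidef M \<longleftrightarrow> transpose M = M \<and> (\<forall>v. 0 \<le> v \<bullet> (M *v v))"

definition pos_def :: "real ^ 'n ^ 'n \<Rightarrow> bool" where
  "pos_def M \<longleftrightarrow> transpose M = M \<and> (\<forall>v. v \<noteq> 0 \<longrightarrow> 0 < v \<bullet> (M *v v))"

definition loewner_le :: "real ^ 'n ^ 'n \<Rightarrow> real ^ 'n ^ 'n \<Rightarrow> bool" (infix "\<preceq>" 50) where
  "A \<preceq> B \<longleftrightarrow> pos_semidef (B - A)"

definition mat_norm :: "real ^ 'n ^ 'n \<Rightarrow> real ^ 'n \<Rightarrow> real" where
  "mat_norm M v = sqrt (v \<bullet> (M *v v))"

definition Diag :: "real ^ 'n \<Rightarrow> real ^ 'n ^ 'n" where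
  "Diag v = (\<chi> i j. if i = j then v $ i else 0)"

definition prob_simplex :: "(real ^ 'm) set" where
  "prob_simplex = {l. (\<forall>i. 0 \<le> l $ i) \<and> (\<Sum>i\<in>UNIV. l $ i) = 1}"

definition max_dir_deriv ::
    "('m::finite \<Rightarrow> real ^ 'n \<Rightarrow> real) \<Rightarrow> real ^ 'n \<Rightarrow> real ^ 'n \<Rightarrow> real" where
  "max_dir_deriv f x d = (MAX i. grad (f i) x \<bullet> d)"

definition Pareto_critical :: "('m \<Rightarrow> real ^ 'n \<Rightarrow> real) \<Rightarrow> real ^ 'n \<Rightarrow> bool" where
  "Pareto_critical f x \<longleftrightarrow> (\<forall>d. \<exists>i. grad (f i) x \<bullet> d \<ge> 0)"

definition level_set :: "('m \<Rightarrow> real ^ 'n \<Rightarrow> real) \<Rightarrow> real ^ 'n \<Rightarrow> (real ^ 'n) set" where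
  "level_set f x0 = {x. \<forall>i. f i x \<le> f i x0}"

definition accumulation_point :: "(nat \<Rightarrow> 'a::topological_space) \<Rightarrow> 'a \<Rightarrow> bool" where
  "accumulation_point X l \<longleftrightarrow> (\<exists>r. strict_mono r \<and> (X \<circ> r) \<longlonglongrightarrow> l)"

text \<open>One iteration that does not stop, from the state \<open>(x_k, B_k, \<alpha>^{k-1})\<close> to the state
  \<open>(x_{k+1}, B_{k+1}, \<alpha>^k)\<close>. The multiplier \<open>l\<close> and the step size \<open>t\<close> are existentially
  quantified because the algorithm leaves their choice open.\<close>
definition BB_DQN_step ::
  "('m::finite \<Rightarrow> real ^ 'n \<Rightarrow> real) \<Rightarrow> real \<Rightarrow> real \<Rightarrow> real \<Rightarrow> real \<Rightarrow> real \<Rightarrow> real \<Rightarrow> real \<Rightarrow>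
   real ^ 'n \<Rightarrow> real ^ 'n ^ 'n \<Rightarrow> real ^ 'n \<Rightarrow> real ^ 'n \<Rightarrow> real ^ 'n ^ 'n \<Rightarrow> real ^ 'n \<Rightarrow> bool" where
  "BB_DQN_step f c0 c1 c2 \<mu> \<sigma>1 \<sigma>2 \<epsilon> x B \<alpha> x' B' \<alpha>' \<longleftrightarrow> (\<exists>l t.
     is_arg_min (\<lambda>z. 1/2 * (mat_norm (matrix_inv B) (\<Sum>i\<in>UNIV. z $ i *\<^sub>R grad (f i) x))\<^sup>2)
       (\<lambda>z. z \<in> prob_simplex) l \<and>
     (let d = - (matrix_inv B *v (\<Sum>i\<in>UNIV. l $ i *\<^sub>R grad (f i) x));
          \<omega> = min c0 (c1 * norm d powr c2);
          s = t *\<^sub>R d;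
          y = (\<Sum>i\<in>UNIV. l $ i *\<^sub>R (grad (f i) x' - grad (f i) x));
          p = (y \<bullet> s) / (norm s)\<^sup>2;
          q = (norm y)\<^sup>2 / (y \<bullet> s);
          use_BB = (s \<bullet> y > 0 \<and> {p..q} \<inter> {\<omega>..1 / \<omega>} \<noteq> {});
          lo = (if use_BB then max p \<omega> else \<omega>);
          hi = (if use_BB then min q (1 / \<omega>) else 1 / \<omega>);
          r = (\<lambda>j. (s $ j * y $ j + \<mu> * \<alpha> $ j) / ((s $ j)\<^sup>2 + \<mu>))
      in \<not> (norm d < \<epsilon> \<or> d = 0) \<and>
         t > 0 \<and>
         (\<forall>i. f i (x + t *\<^sub>R d) \<le> f i x + \<sigma>1 * t * max_dir_deriv f x d) \<and>
         max_dir_deriv f (x + t *\<^sub>R d) d \<ge> \<sigma>2 * max_dir_deriv f x d \<and>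
         x' = x + t *\<^sub>R d \<and>
         \<alpha>' = (\<chi> j. if r j < lo then lo else if r j > hi then hi else r j) \<and>
         B' = Diag \<alpha>'))"

text \<open>Index shift: \<open>\<alpha> k\<close> is the vector \<open>\<alpha>^{k-1}\<close> that iteration \<open>k\<close> starts from, so \<open>\<alpha> 0\<close> is the
  given initial vector \<open>\<alpha>^{-1}\<close> and \<open>B (Suc k) = Diag (\<alpha> (Suc k))\<close>. The run is infinite: the
  stopping test fails in every iteration.\<close>
definition BB_DQN_sequence ::
  "('m::finite \<Rightarrow> real ^ 'n \<Rightarrow> real) \<Rightarrow> real \<Rightarrow> real \<Rightarrow> real \<Rightarrow> real \<Rightarrow> real \<Rightarrow> real \<Rightarrow> real \<Rightarrow>
   real ^ 'n \<Rightarrow> real ^ 'n ^ 'n \<Rightarrow> real ^ 'n \<Rightarrow>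
   (nat \<Rightarrow> real ^ 'n) \<Rightarrow> (nat \<Rightarrow> real ^ 'n ^ 'n) \<Rightarrow> (nat \<Rightarrow> real ^ 'n) \<Rightarrow> bool" where
  "BB_DQN_sequence f c0 c1 c2 \<mu> \<sigma>1 \<sigma>2 \<epsilon> x0 B0 \<alpha>0 x B \<alpha> \<longleftrightarrow>
     x 0 = x0 \<and> B 0 = B0 \<and> \<alpha> 0 = \<alpha>0 \<and>
     (\<forall>k. BB_DQN_step f c0 c1 c2 \<mu> \<sigma>1 \<sigma>2 \<epsilon>
            (x k) (B k) (\<alpha> k) (x (Suc k)) (B (Suc k)) (\<alpha> (Suc k)))"

end

theory Submission
  imports Defs
begin

text \<open>
  The Loewner bounds make every direction a uniform descent direction, so the steps decrease each
  component of \<open>f\<close> by an amount that forces the directions to vanish. Write \<open>g\<close> for the convex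
  combination of the gradients that is optimal for the dual subproblem, so that \<open>B *v d = - g\<close>.

  The first-order condition for the dual problem says that every gradient \<open>h\<close> satisfies
  \<open>h \<bullet> d \<le> g \<bullet> d = - (d \<bullet> (B *v d)) \<le> - a * (norm d)\<^sup>2\<close> (\<open>dual_direction_descent\<close>). With the
  first Wolfe condition all components of \<open>f\<close> decrease, and the iterates stay in the level set.
  With the second Wolfe condition and the Lipschitz bound at the two consecutive iterates, the
  step size is bounded below by a positive constant (\<open>wolfe_step_size_lower_bound\<close>). Hence the
  decrease of a component in a step is at least a constant multiple of \<open>(norm d)\<^sup>2\<close>. The level set
  is compact, so the components are bounded below along the run, the decreases tend to zero, and so
  do the directions (\<open>tendsto_zero_of_sufficient_decrease\<close>).

  If the limit of a subsequence were not Pareto critical, a vector \<open>v\<close> would have inner products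
  below some \<open>- \<delta> < 0\<close> with all gradients there, and by continuity eventually also with the
  gradients along the subsequence; so \<open>- (g \<bullet> v) = v \<bullet> (B *v d)\<close> would eventually be at least
  \<open>\<delta>\<close> there. But \<open>v \<bullet> (B *v d)\<close> is at most of the order of \<open>norm d\<close> because \<open>B\<close> is bounded by
  \<open>b\<close> (\<open>bilinear_form_le_norm\<close>), a contradiction (\<open>Pareto_critical_of_vanishing_directions\<close>).
\<close>

section \<open>Quadratic forms\<close>

lemma symmetric_matrix_inner:
  fixes M :: "real ^ 'n ^ 'n"
  assumes "transpose M = M"
  shows "u \<bullet> (M *v v) = (M *v u) \<bullet> v"
  by (metis assms dot_lmul_matrix transpose_matrix_vector)

lemma mat_mult_vec: "(mat c :: real ^ 'n ^ 'n) *v v = c *\<^sub>R v"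
proof -
  have "(mat c :: real ^ 'n ^ 'n) = c *\<^sub>R mat 1"
    by (simp add: mat_def vec_eq_iff)
  then show ?thesis
    by (simp add: scaleR_matrix_vector_assoc [symmetric])
qed

lemma loewner_lower_bound:
  fixes M :: "real ^ 'n ^ 'n"
  assumes "mat a \<preceq> M"
  shows "a * (norm v)\<^sup>2 \<le> v \<bullet> (M *v v)"
  using assms
  by (auto simp: loewner_le_def pos_semidef_def matrix_vector_mult_diff_rdistrib mat_mult_vec
      inner_diff_right power2_norm_eq_inner)

lemma loewner_upper_bound:
  fixes M :: "real ^ 'n ^ 'n"
  assumes "M \<preceq> mat b"
  shows "v \<bullet> (M *v v) \<le> b * (norm v)\<^sup>2"
  using assms
  by (auto simp: loewner_le_def pos_semidef_def matrix_vector_mult_diff_rdistrib mat_mult_vec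
      inner_diff_right power2_norm_eq_inner)

lemma loewner_mat_symmetric:
  fixes M :: "real ^ 'n ^ 'n"
  assumes "mat a \<preceq> M"
  shows "transpose M = M"
proof -
  have "transpose (M - mat a) = M - mat a"
    using assms by (simp add: loewner_le_def pos_semidef_def)
  then have "M $ j $ i = M $ i $ j" for i j
    by (cases "i = j") (auto simp: transpose_def mat_def dest!: arg_cong [where f = "\<lambda>A. A $ i $ j"])
  then show ?thesis
    by (simp add: transpose_def vec_eq_iff)
qed

text \<open>Expanding the form at \<open>norm d *\<^sub>R v - d\<close>, where it is nonnegative, balances the two
  diagonal terms and leaves a bound that is linear in \<open>norm d\<close>.\<close>
lemma bilinear_form_le_norm:
  fixes M :: "real ^ 'n ^ 'n"
  assumes "mat a \<preceq> M" "M \<preceq> mat b" "0 \<le> a" "d \<noteq> 0"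
  shows "2 * (v \<bullet> (M *v d)) \<le> norm d * (b * ((norm v)\<^sup>2 + 1))"
proof -
  define e where "e = norm d"
  have e: "e > 0" using assms by (simp add: e_def)
  have sym: "d \<bullet> (M *v v) = v \<bullet> (M *v d)"
    using symmetric_matrix_inner [OF loewner_mat_symmetric [OF assms(1)]]
    by (simp add: inner_commute)
  have "0 \<le> a * (norm (e *\<^sub>R v - d))\<^sup>2"
    using assms by simp
  also have "\<dots> \<le> (e *\<^sub>R v - d) \<bullet> (M *v (e *\<^sub>R v - d))"
    using assms(1) by (rule loewner_lower_bound)
  also have "\<dots> = e\<^sup>2 * (v \<bullet> (M *v v)) - 2 * e * (v \<bullet> (M *v d)) + d \<bullet> (M *v d)"
    by (simp add: matrix_vector_mult_diff_distrib matrix_vector_mult_scaleR inner_diff_left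
        inner_diff_right sym power2_eq_square algebra_simps)
  finally have "2 * e * (v \<bullet> (M *v d)) \<le> e\<^sup>2 * (v \<bullet> (M *v v)) + d \<bullet> (M *v d)"
    by simp
  also have "\<dots> \<le> e\<^sup>2 * (b * (norm v)\<^sup>2) + b * e\<^sup>2"
    unfolding e_def
    by (intro add_mono mult_left_mono loewner_upper_bound assms) simp
  finally have "e * (2 * (v \<bullet> (M *v d))) \<le> e * (e * (b * ((norm v)\<^sup>2 + 1)))"
    by (simp add: power2_eq_square algebra_simps)
  with e show ?thesis
    by (simp add: e_def)
qed

text \<open>Along the segment from the minimizer \<open>w\<close> to \<open>u\<close> the form is a quadratic polynomial in the
  segment parameter, so its slope at \<open>w\<close> cannot be negative.\<close>
lemma quadratic_form_minimizer_first_order: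
  fixes M :: "real ^ 'n ^ 'n"
  assumes sym: "transpose M = M" and "convex S" "w \<in> S" "u \<in> S"
    and min: "\<And>z. z \<in> S \<Longrightarrow> w \<bullet> (M *v w) \<le> z \<bullet> (M *v z)"
  shows "w \<bullet> (M *v w) \<le> u \<bullet> (M *v w)"
proof (rule ccontr)
  define h where "h = u - w"
  define p where "p = h \<bullet> (M *v w)"
  define q where "q = h \<bullet> (M *v h)"
  assume "\<not> ?thesis"
  then have p: "p < 0" by (simp add: p_def h_def inner_diff_left)
  have pos: "0 \<le> 2 * p + s * q" if s: "0 < s" "s \<le> 1" for s
  proof -
    have "w + s *\<^sub>R h = (1 - s) *\<^sub>R w + s *\<^sub>R u"
      by (simp add: h_def algebra_simps)
    also have "\<dots> \<in> S"
      using s assms(2-4) by (intro convexD) auto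
    finally have "w \<bullet> (M *v w) \<le> (w + s *\<^sub>R h) \<bullet> (M *v (w + s *\<^sub>R h))"
      by (rule min)
    also have "\<dots> = w \<bullet> (M *v w) + s * (2 * p + s * q)"
      using symmetric_matrix_inner [OF sym, of w h]
      by (simp add: p_def q_def matrix_vector_right_distrib matrix_vector_mult_scaleR
          inner_add_left inner_add_right inner_commute algebra_simps)
    finally show ?thesis
      using s by (simp add: zero_le_mult_iff)
  qed
  \<comment> \<open>With this \<open>s\<close>, \<open>s * q\<close> is at most \<open>- p\<close>, so \<open>2 * p + s * q \<le> p < 0\<close>.\<close>
  define s where "s = min 1 (- p / (\<bar>q\<bar> + 1))"
  have s: "0 < s" "s \<le> 1" and "s \<le> - p / (\<bar>q\<bar> + 1)"
    using p by (auto simp: s_def divide_neg_pos)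
  then have "s * (\<bar>q\<bar> + 1) \<le> - p"
    by (subst pos_le_divide_eq [symmetric]) simp_all
  moreover have "s * q \<le> s * (\<bar>q\<bar> + 1)"
    using s by (intro mult_left_mono) auto
  ultimately show False
    using pos [OF s] p by linarith
qed

lemma matrix_inv_of_loewner_bounded_below:
  fixes B :: "real ^ 'n ^ 'n"
  assumes "mat a \<preceq> B" "0 < a"
  shows "B *v (matrix_inv B *v v) = v"
    and "transpose (matrix_inv B) = matrix_inv B"
    and "0 \<le> v \<bullet> (matrix_inv B *v v)"
proof -
  have "v = 0" if "B *v v = 0" for v
  proof -
    have "a * (norm v)\<^sup>2 \<le> 0"
      using loewner_lower_bound [OF assms(1), of v] that by simp
    then show ?thesis
      using assms(2) by (simp add: mult_le_0_iff)
  qed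
  then have "invertible B"
    by (simp add: invertible_left_inverse matrix_left_invertible_ker)
  then have inv: "B ** matrix_inv B = mat 1" "matrix_inv B ** B = mat 1"
    unfolding invertible_def matrix_inv_def by (metis (mono_tags, lifting) someI_ex)+
  show Binv: "B *v (matrix_inv B *v v) = v" for v
    by (simp add: matrix_vector_mul_assoc inv)
  show "transpose (matrix_inv B) = matrix_inv B"
  proof -
    have "transpose (matrix_inv B) ** B = mat 1"
      using loewner_mat_symmetric [OF assms(1)] inv(1) by (metis matrix_transpose_mul transpose_mat)
    then show ?thesis
      by (metis inv(1) matrix_mul_assoc matrix_mul_lid matrix_mul_rid)
  qed
  have "0 \<le> a * (norm (matrix_inv B *v v))\<^sup>2"
    using assms by simp
  also have "\<dots> \<le> (matrix_inv B *v v) \<bullet> (B *v (matrix_inv B *v v))"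
    by (rule loewner_lower_bound [OF assms(1)])
  finally show "0 \<le> v \<bullet> (matrix_inv B *v v)"
    by (simp add: Binv inner_commute)
qed

section \<open>The search direction\<close>

lemma convex_prob_simplex: "convex prob_simplex"
  unfolding prob_simplex_def convex_def
  by (auto simp: sum.distrib sum_distrib_left [symmetric])

lemma axis_in_prob_simplex: "axis i 1 \<in> prob_simplex"
  by (auto simp: prob_simplex_def axis_def)

lemma prob_simplex_sum_le:
  assumes "l \<in> prob_simplex" "\<And>i. h i \<le> c"
  shows "(\<Sum>i\<in>UNIV. l $ i * h i) \<le> c"
proof -
  have "(\<Sum>i\<in>UNIV. l $ i * h i) \<le> (\<Sum>i\<in>UNIV. l $ i * c)"
    using assms by (intro sum_mono mult_left_mono) (auto simp: prob_simplex_def)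
  also have "\<dots> = c"
    using assms by (simp add: prob_simplex_def sum_distrib_right [symmetric])
  finally show ?thesis .
qed

text \<open>The dual objective is a quadratic form on the convex hull of the gradients; the vertices of
  the simplex give the test points \<open>G i\<close> in its first-order condition, which in terms of \<open>d\<close>
  reads \<open>G i \<bullet> d \<le> - (d \<bullet> (B *v d))\<close>.\<close>
lemma dual_direction_descent:
  fixes B :: "real ^ 'n ^ 'n" and G :: "'m::finite \<Rightarrow> real ^ 'n"
  assumes B: "mat a \<preceq> B" "0 < a"
    and argmin: "is_arg_min (\<lambda>z. 1/2 * (mat_norm (matrix_inv B) (\<Sum>i\<in>UNIV. z $ i *\<^sub>R G i))\<^sup>2)
       (\<lambda>z. z \<in> prob_simplex) l"
    and d: "d = - (matrix_inv B *v (\<Sum>i\<in>UNIV. l $ i *\<^sub>R G i))"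
  shows "G i \<bullet> d \<le> - (a * (norm d)\<^sup>2)"
proof -
  note inv = matrix_inv_of_loewner_bounded_below [OF B]
  define comb where "comb = (\<lambda>z :: real ^ 'm. \<Sum>i\<in>UNIV. z $ i *\<^sub>R G i)"
  define M where "M = matrix_inv B"
  have l: "l \<in> prob_simplex"
    using argmin by (simp add: is_arg_min_def)
  have "linear comb"
    unfolding comb_def
    by (rule linearI) (simp_all add: scaleR_left_distrib sum.distrib scaleR_sum_right)
  then have convex: "convex (comb ` prob_simplex)"
    by (rule convex_linear_image [OF _ convex_prob_simplex])
  have min: "comb l \<bullet> (M *v comb l) \<le> v \<bullet> (M *v v)" if "v \<in> comb ` prob_simplex" for v
    using that argmin inv(3) by (auto simp: is_arg_min_def mat_norm_def comb_def M_def not_less)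
  have "comb (axis i 1) = G i"
    by (simp add: comb_def axis_def if_distrib [of "\<lambda>c. c *\<^sub>R _"] cong: if_cong)
  then have "G i \<in> comb ` prob_simplex"
    using axis_in_prob_simplex by (metis imageI)
  then have "comb l \<bullet> (M *v comb l) \<le> G i \<bullet> (M *v comb l)"
    using l min inv(2) convex
    by (intro quadratic_form_minimizer_first_order [where S = "comb ` prob_simplex"])
      (auto simp: M_def)
  then have "G i \<bullet> d \<le> comb l \<bullet> d"
    by (simp add: d comb_def M_def)
  also have "comb l = - (B *v d)"
    unfolding d linear_neg [OF matrix_vector_mul_linear] inv(1) by (simp add: comb_def)
  also have "- (B *v d) \<bullet> d \<le> - (a * (norm d)\<^sup>2)"
    using loewner_lower_bound [OF B(1), of d] by (simp add: inner_commute)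
  finally show ?thesis .
qed

section \<open>One iteration\<close>

lemma max_dir_deriv_le_iff: "max_dir_deriv f x d \<le> c \<longleftrightarrow> (\<forall>i. grad (f i) x \<bullet> d \<le> c)"
  by (simp add: max_dir_deriv_def)

lemma max_dir_deriv_ge: "grad (f i) x \<bullet> d \<le> max_dir_deriv f x d"
  using max_dir_deriv_le_iff by blast

lemma max_dir_deriv_attained: "\<exists>i. max_dir_deriv f x d = grad (f i) x \<bullet> d"
proof -
  have "max_dir_deriv f x d \<in> range (\<lambda>i. grad (f i) x \<bullet> d)"
    unfolding max_dir_deriv_def by (rule Max_in) auto
  then show ?thesis by auto
qed

text \<open>The interface between the algorithm and the convergence analysis: the optimality of
  the multiplier enters through the bound on the directional derivatives, and the inverse of \<open>B\<close>
  is traded for a linear system.\<close>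
lemma BB_DQN_step_descent:
  fixes f :: "'m::finite \<Rightarrow> real ^ 'n \<Rightarrow> real"
  assumes "BB_DQN_step f c0 c1 c2 \<mu> \<sigma>1 \<sigma>2 \<epsilon> x B \<alpha> x' B' \<alpha>'"
    and B: "mat a \<preceq> B" "0 < a" and "0 < \<sigma>1"
  obtains l d t where "l \<in> prob_simplex" "B *v d = - (\<Sum>i\<in>UNIV. l $ i *\<^sub>R grad (f i) x)"
    "d \<noteq> 0" "0 < t" "x' = x + t *\<^sub>R d"
    "max_dir_deriv f x d \<le> - (a * (norm d)\<^sup>2)"
    "\<And>i. f i x' \<le> f i x - \<sigma>1 * t * (a * (norm d)\<^sup>2)"
    "\<sigma>2 * max_dir_deriv f x d \<le> max_dir_deriv f x' d"
proof -
  obtain l t d where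
    argmin: "is_arg_min
       (\<lambda>z. 1/2 * (mat_norm (matrix_inv B) (\<Sum>i\<in>UNIV. z $ i *\<^sub>R grad (f i) x))\<^sup>2)
       (\<lambda>z. z \<in> prob_simplex) l"
    and d: "d = - (matrix_inv B *v (\<Sum>i\<in>UNIV. l $ i *\<^sub>R grad (f i) x))"
    and step: "d \<noteq> 0" "0 < t" "x' = x + t *\<^sub>R d"
      "\<sigma>2 * max_dir_deriv f x d \<le> max_dir_deriv f x' d"
    and armijo: "\<And>i. f i x' \<le> f i x + \<sigma>1 * t * max_dir_deriv f x d"
    using assms(1) unfolding BB_DQN_step_def Let_def by blast
  have l: "l \<in> prob_simplex"
    using argmin by (simp add: is_arg_min_def)
  have Bd: "B *v d = - (\<Sum>i\<in>UNIV. l $ i *\<^sub>R grad (f i) x)"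
    by (simp add: d linear_neg [OF matrix_vector_mul_linear]
        matrix_inv_of_loewner_bounded_below(1) [OF B])
  have D: "max_dir_deriv f x d \<le> - (a * (norm d)\<^sup>2)"
    using dual_direction_descent [OF B argmin d] by (simp add: max_dir_deriv_le_iff)
  have "f i x' \<le> f i x - \<sigma>1 * t * (a * (norm d)\<^sup>2)" for i
  proof -
    have "\<sigma>1 * t * max_dir_deriv f x d \<le> \<sigma>1 * t * - (a * (norm d)\<^sup>2)"
      using D step(2) \<open>0 < \<sigma>1\<close> by (intro mult_left_mono) auto
    with armijo [of i] show ?thesis by simp
  qed
  with l Bd step D that show ?thesis by blast
qed

text \<open>The curvature condition forces the directional derivative of some component to grow by
  \<open>(1 - \<sigma>2) * a * (norm d)\<^sup>2\<close> along the step, while the Lipschitz bound between the endpoints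
  allows at most \<open>K * t * (norm d)\<^sup>2\<close>.\<close>
lemma wolfe_step_size_lower_bound:
  fixes f :: "'m::finite \<Rightarrow> real ^ 'n \<Rightarrow> real"
  assumes "d \<noteq> 0" "0 < t" "\<sigma>2 < 1" "0 < K"
    and D: "max_dir_deriv f x d \<le> - (a * (norm d)\<^sup>2)"
    and wolfe: "\<sigma>2 * max_dir_deriv f x d \<le> max_dir_deriv f (x + t *\<^sub>R d) d"
    and lip: "\<And>i. norm (grad (f i) (x + t *\<^sub>R d) - grad (f i) x) \<le> K * norm (t *\<^sub>R d)"
  shows "(1 - \<sigma>2) * a / K \<le> t"
proof -
  obtain i where i: "max_dir_deriv f (x + t *\<^sub>R d) d = grad (f i) (x + t *\<^sub>R d) \<bullet> d"
    using max_dir_deriv_attained by blast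
  have "(1 - \<sigma>2) * (a * (norm d)\<^sup>2) \<le> (1 - \<sigma>2) * - max_dir_deriv f x d"
    using D \<open>\<sigma>2 < 1\<close> by (intro mult_left_mono) auto
  also have "\<dots> = \<sigma>2 * max_dir_deriv f x d - max_dir_deriv f x d"
    by (simp add: algebra_simps)
  also have "\<dots> \<le> grad (f i) (x + t *\<^sub>R d) \<bullet> d - grad (f i) x \<bullet> d"
    using wolfe max_dir_deriv_ge [of f i x d] by (simp add: i)
  also have "\<dots> = (grad (f i) (x + t *\<^sub>R d) - grad (f i) x) \<bullet> d"
    by (simp add: inner_diff_left)
  also have "\<dots> \<le> norm (grad (f i) (x + t *\<^sub>R d) - grad (f i) x) * norm d"
    by (rule norm_cauchy_schwarz)
  also have "\<dots> \<le> K * norm (t *\<^sub>R d) * norm d"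
    using lip by (intro mult_right_mono) auto
  also have "\<dots> = K * t * (norm d)\<^sup>2"
    using \<open>0 < t\<close> by (simp add: power2_eq_square)
  finally have "((1 - \<sigma>2) * a) * (norm d)\<^sup>2 \<le> (K * t) * (norm d)\<^sup>2"
    by (simp add: mult.assoc)
  then have "(1 - \<sigma>2) * a \<le> K * t"
    using \<open>d \<noteq> 0\<close> by simp
  then show ?thesis
    using \<open>0 < K\<close> by (simp add: pos_divide_le_eq mult.commute)
qed

section \<open>Convergence\<close>

lemma tendsto_zero_of_sufficient_decrease:
  fixes F :: "nat \<Rightarrow> real" and d :: "nat \<Rightarrow> 'a::real_normed_vector"
  assumes bdd: "\<And>k. c \<le> F k" and "0 < \<gamma>"
    and dec: "\<And>k. F (Suc k) \<le> F k - \<gamma> * (norm (d k))\<^sup>2"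
  shows "d \<longlonglongrightarrow> 0"
proof -
  have "decseq F"
    using dec \<open>0 < \<gamma>\<close> by (intro decseq_SucI) (smt (verit) mult_nonneg_nonneg zero_le_power2)
  then obtain L where L: "F \<longlonglongrightarrow> L"
    using decseq_convergent bdd by blast
  have "(\<lambda>k. (F k - F (Suc k)) / \<gamma>) \<longlonglongrightarrow> (L - L) / \<gamma>"
    using \<open>0 < \<gamma>\<close> by (intro tendsto_intros L LIMSEQ_Suc) auto
  then have lim: "(\<lambda>k. (F k - F (Suc k)) / \<gamma>) \<longlonglongrightarrow> 0"
    by simp
  have "(norm (d k))\<^sup>2 \<le> (F k - F (Suc k)) / \<gamma>" for k
    using dec [of k] \<open>0 < \<gamma>\<close> by (simp add: pos_le_divide_eq algebra_simps)
  then have "(\<lambda>k. (norm (d k))\<^sup>2) \<longlonglongrightarrow> 0"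
    by (intro tendsto_sandwich [OF _ _ tendsto_const lim]) auto
  then have "(\<lambda>k. sqrt ((norm (d k))\<^sup>2)) \<longlonglongrightarrow> sqrt 0"
    by (rule tendsto_real_sqrt)
  then show ?thesis
    by (simp add: tendsto_norm_zero_iff)
qed

lemma cont_differentiable_continuous_on:
  "cont_differentiable h \<Longrightarrow> continuous_on S h"
  unfolding cont_differentiable_def
  by (blast intro: continuous_at_imp_continuous_on differentiable_imp_continuous_within)

lemma closed_level_set:
  assumes "\<And>i. cont_differentiable (f i)"
  shows "closed (level_set f x0)"
  unfolding level_set_def
  by (intro closed_Collect_all closed_Collect_le [OF _ continuous_on_const]
      cont_differentiable_continuous_on assms)

text \<open>A vector \<open>v\<close> that witnesses that a point is not Pareto critical has negative inner
  products, bounded away from zero, with all gradients near that point, hence also with their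
  convex combinations \<open>- (B k *v d k)\<close>; but these inner products tend to zero with \<open>d\<close>.\<close>
lemma Pareto_critical_of_vanishing_directions:
  fixes f :: "'m::finite \<Rightarrow> real ^ 'n \<Rightarrow> real" and B :: "nat \<Rightarrow> real ^ 'n ^ 'n"
  assumes cont: "\<And>i. continuous_on UNIV (grad (f i))"
    and B: "\<And>k. mat a \<preceq> B k" "\<And>k. B k \<preceq> mat b" "0 \<le> a"
    and l: "\<And>k. l k \<in> prob_simplex"
    and Bd: "\<And>k. B k *v d k = - (\<Sum>i\<in>UNIV. l k $ i *\<^sub>R grad (f i) (x k))"
    and "\<And>k. d k \<noteq> 0" "d \<longlonglongrightarrow> 0" "x \<longlonglongrightarrow> xstar"
  shows "Pareto_critical f xstar"
proof (rule ccontr)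
  assume "\<not> ?thesis"
  then obtain v where v: "\<And>i. grad (f i) xstar \<bullet> v < 0"
    by (auto simp: Pareto_critical_def not_le)
  define \<delta> where "\<delta> = - max_dir_deriv f xstar v / 2"
  have \<delta>: "0 < \<delta>"
    using v max_dir_deriv_attained [of f xstar v] unfolding \<delta>_def
    by (smt (verit) half_gt_zero_iff)
  have lt: "grad (f i) xstar \<bullet> v < - \<delta>" for i
    using max_dir_deriv_ge [of f i xstar v] \<delta> by (simp add: \<delta>_def)
  have "(\<lambda>k. grad (f i) (x k) \<bullet> v) \<longlonglongrightarrow> grad (f i) xstar \<bullet> v" for i
    using \<open>x \<longlonglongrightarrow> xstar\<close>
    by (intro tendsto_inner [OF _ tendsto_const] continuous_on_tendsto_compose [OF cont]) auto
  then have "\<forall>\<^sub>F k in sequentially. grad (f i) (x k) \<bullet> v < - \<delta>" for i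
    by (rule order_tendstoD(2)) (rule lt)
  then have ev: "\<forall>\<^sub>F k in sequentially. \<forall>i. grad (f i) (x k) \<bullet> v < - \<delta>"
    by (simp add: eventually_all_finite)
  have "(\<lambda>k. norm (d k) * (b * ((norm v)\<^sup>2 + 1))) \<longlonglongrightarrow> 0"
    using \<open>d \<longlonglongrightarrow> 0\<close> by (intro tendsto_mult_left_zero tendsto_norm_zero)
  then have "\<forall>\<^sub>F k in sequentially. norm (d k) * (b * ((norm v)\<^sup>2 + 1)) < 2 * \<delta>"
    using \<delta> by (intro order_tendstoD(2)) auto
  with ev have "\<forall>\<^sub>F k in sequentially. False"
  proof eventually_elim
    case (elim k)
    have "- (v \<bullet> (B k *v d k)) = (\<Sum>i\<in>UNIV. l k $ i * (grad (f i) (x k) \<bullet> v))"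
      by (simp add: Bd inner_sum_right inner_commute)
    also have "\<dots> \<le> - \<delta>"
      using elim(1) l by (intro prob_simplex_sum_le) (auto intro: less_imp_le)
    finally have "2 * \<delta> \<le> 2 * (v \<bullet> (B k *v d k))"
      by simp
    also have "\<dots> \<le> norm (d k) * (b * ((norm v)\<^sup>2 + 1))"
      using assms(2-4,7) by (intro bilinear_form_le_norm) auto
    finally show False
      using elim(2) by simp
  qed
  then show False
    by simp
qed

theorem theorem4p3:
  fixes f :: "'m::finite \<Rightarrow> real ^ 'n \<Rightarrow> real"
    and c0 c1 c2 \<mu> \<sigma>1 \<sigma>2 \<epsilon> a b :: real
    and x0 \<alpha>0 xstar :: "real ^ 'n" and B0 :: "real ^ 'n ^ 'n"
    and x \<alpha> :: "nat \<Rightarrow> real ^ 'n" and B :: "nat \<Rightarrow> real ^ 'n ^ 'n"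
    and C :: "(real ^ 'n) set" and L :: "'m \<Rightarrow> real"
  assumes "\<And>i. cont_differentiable (f i)"
    and "0 < c0" "c0 \<le> 1" "0 < c1" "0 < c2" "0 < \<mu>"
    and "0 < \<sigma>1" "\<sigma>1 < \<sigma>2" "\<sigma>2 < 1" "0 \<le> \<epsilon>"
    and "pos_def B0" and "\<And>j. 0 < \<alpha>0 $ j"
    and "BB_DQN_sequence f c0 c1 c2 \<mu> \<sigma>1 \<sigma>2 \<epsilon> x0 B0 \<alpha>0 x B \<alpha>"
    and "bounded (level_set f x0)"
    and "open C" "level_set f x0 \<subseteq> C" "\<And>i. 0 < L i"
    and "\<And>i u v. u \<in> C \<Longrightarrow> v \<in> C \<Longrightarrow> norm (grad (f i) u - grad (f i) v) \<le> L i * norm (u - v)"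
    and "0 < a" "a \<le> b" "\<And>k. mat a \<preceq> B k \<and> B k \<preceq> mat b"
    and "accumulation_point x xstar"
  shows "Pareto_critical f xstar"
proof -
  have step: "BB_DQN_step f c0 c1 c2 \<mu> \<sigma>1 \<sigma>2 \<epsilon>
      (x k) (B k) (\<alpha> k) (x (Suc k)) (B (Suc k)) (\<alpha> (Suc k))" for k
    using assms(13) by (auto simp: BB_DQN_sequence_def)
  have x_0: "x 0 = x0"
    using assms(13) by (simp add: BB_DQN_sequence_def)
  have B: "mat a \<preceq> B k" "B k \<preceq> mat b" for k
    using assms(21) by auto
  define descent where "descent = (\<lambda>k l d t.
      l \<in> prob_simplex \<and> B k *v d = - (\<Sum>i\<in>UNIV. l $ i *\<^sub>R grad (f i) (x k)) \<and>
      d \<noteq> 0 \<and> 0 < t \<and> x (Suc k) = x k + t *\<^sub>R d \<and>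
      max_dir_deriv f (x k) d \<le> - (a * (norm d)\<^sup>2) \<and>
      (\<forall>i. f i (x (Suc k)) \<le> f i (x k) - \<sigma>1 * t * (a * (norm d)\<^sup>2)) \<and>
      \<sigma>2 * max_dir_deriv f (x k) d \<le> max_dir_deriv f (x (Suc k)) d)"
  have "\<exists>l d t. descent k l d t" for k
    unfolding descent_def
    by (rule BB_DQN_step_descent [OF step B(1) \<open>0 < a\<close> \<open>0 < \<sigma>1\<close>]) blast
  then obtain l d t where descent: "\<And>k. descent k (l k) (d k) (t k)"
    by metis
  have l: "l k \<in> prob_simplex"
    and Bd: "B k *v d k = - (\<Sum>i\<in>UNIV. l k $ i *\<^sub>R grad (f i) (x k))"
    and d: "d k \<noteq> 0" and t: "0 < t k"
    and x_Suc: "x (Suc k) = x k + t k *\<^sub>R d k"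
    and D: "max_dir_deriv f (x k) (d k) \<le> - (a * (norm (d k))\<^sup>2)"
    and dec: "f i (x (Suc k)) \<le> f i (x k) - \<sigma>1 * t k * (a * (norm (d k))\<^sup>2)"
    and wolfe: "\<sigma>2 * max_dir_deriv f (x k) (d k) \<le> max_dir_deriv f (x (Suc k)) (d k)" for i k
    using descent [of k] unfolding descent_def by blast+
  have level: "x k \<in> level_set f x0" for k
  proof (induction k)
    case 0
    show ?case by (simp add: level_set_def x_0)
  next
    case (Suc k)
    have "0 \<le> \<sigma>1 * t k * (a * (norm (d k))\<^sup>2)"
      using t [of k] \<open>0 < \<sigma>1\<close> \<open>0 < a\<close> by simp
    with Suc dec [where k = k] show ?case
      unfolding level_set_def by (smt (verit) mem_Collect_eq)
  qed
  define K where "K = Max (range L)"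
  have LK: "L i \<le> K" for i
    by (simp add: K_def)
  with \<open>\<And>i. 0 < L i\<close> have K: "0 < K"
    by (meson less_le_trans)
  define \<tau> where "\<tau> = (1 - \<sigma>2) * a / K"
  have \<tau>: "0 < \<tau>"
    using \<open>\<sigma>2 < 1\<close> \<open>0 < a\<close> K by (simp add: \<tau>_def)
  have lip: "norm (grad (f i) (x k + t k *\<^sub>R d k) - grad (f i) (x k)) \<le> K * norm (t k *\<^sub>R d k)"
    for i k
  proof -
    have "norm (grad (f i) (x (Suc k)) - grad (f i) (x k)) \<le> L i * norm (x (Suc k) - x k)"
      using level assms(16,18) by blast
    also have "\<dots> \<le> K * norm (x (Suc k) - x k)"
      by (intro mult_right_mono LK norm_ge_zero)
    finally show ?thesis
      by (simp add: x_Suc)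
  qed
  have step_size: "\<tau> \<le> t k" for k
    unfolding \<tau>_def
    using wolfe [of k] by (intro wolfe_step_size_lower_bound [OF d t \<open>\<sigma>2 < 1\<close> K D _ lip])
      (simp add: x_Suc)
  \<comment> \<open>All components decrease alike, so any single one shows that the directions vanish.\<close>
  obtain i :: 'm where True by simp
  have "compact (level_set f x0)"
    using assms(14) closed_level_set [of f, OF assms(1)] by (simp add: compact_eq_bounded_closed)
  then obtain z where z: "\<And>u. u \<in> level_set f x0 \<Longrightarrow> f i z \<le> f i u"
    using continuous_attains_inf [OF _ _ cont_differentiable_continuous_on [OF assms(1)]] level
    by (metis empty_iff)
  have "d \<longlonglongrightarrow> 0"
  proof (rule tendsto_zero_of_sufficient_decrease [where F = "\<lambda>k. f i (x k)"])
    show "f i z \<le> f i (x k)" for k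
      using level by (rule z)
    show "0 < \<sigma>1 * \<tau> * a"
      using \<tau> \<open>0 < \<sigma>1\<close> \<open>0 < a\<close> by simp
    show "f i (x (Suc k)) \<le> f i (x k) - \<sigma>1 * \<tau> * a * (norm (d k))\<^sup>2" for k
    proof -
      have "\<sigma>1 * \<tau> * (a * (norm (d k))\<^sup>2) \<le> \<sigma>1 * t k * (a * (norm (d k))\<^sup>2)"
        using step_size [of k] \<open>0 < \<sigma>1\<close> \<open>0 < a\<close> by (intro mult_right_mono mult_left_mono) auto
      with dec [where i = i and k = k] show ?thesis
        by (simp add: mult.assoc)
    qed
  qed
  obtain r where r: "strict_mono r" "(x \<circ> r) \<longlonglongrightarrow> xstar"
    using assms(22) by (auto simp: accumulation_point_def)
  show ?thesis
  proof (rule Pareto_critical_of_vanishing_directions)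
    show "(d \<circ> r) \<longlonglongrightarrow> 0"
      using \<open>d \<longlonglongrightarrow> 0\<close> r(1) by (rule LIMSEQ_subseq_LIMSEQ)
    show "continuous_on UNIV (grad (f i))" for i
      using assms(1) by (simp add: cont_differentiable_def)
    show "mat a \<preceq> (B \<circ> r) k" "(B \<circ> r) k \<preceq> mat b" for k
      using B by auto
    show "0 \<le> a"
      using \<open>0 < a\<close> by simp
    show "(l \<circ> r) k \<in> prob_simplex" for k
      by (simp add: l)
    show "(B \<circ> r) k *v (d \<circ> r) k =
        - (\<Sum>i\<in>UNIV. (l \<circ> r) k $ i *\<^sub>R grad (f i) ((x \<circ> r) k))" for k
      by (simp add: Bd)
    show "(d \<circ> r) k \<noteq> 0" for k
      by (simp add: d)
  qed (rule r(2))
qed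

end
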